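(* Let $c,b\in\mathbb{R}$ with $c<b$, and let $f:[c,b]\to\mathbb{R}$ be a function such that $c$ is the unique root of $f$ in $[c,b]$. Assume that $f'(x)$ and $f''(x)$ exist for each $x\in(c,b)$, that the right derivative $f'(c+)$ of $f$ at $c$ and the left derivative $f'(b-)$ of $f$ at $b$ exist, and that: (i) $f(x)f''(x)\ge 0$ for each $x\in(c,b)$; (ii) $f(x)f'(x)>0$ for each $x\in(c,b]$; (iii) $f'(x)\neq 0$ for each $x\in(c,b)$, $f'(c+)\neq 0$ and $f'(b-)\neq 0$. For any $x_0\in[c,b]$ define $$x_{n+1}=x_n-\frac{f(x_n)}{f'(x_n)}\quad\text{for all } n\ge 0.$$ Then the sequence $\{x_n\}$ converges to $c$ as $n\to\infty$.
   Context: $f'(c+)$ and $f'(b-)$ denote the (finite) one-sided derivatives of $f$ at the endpoints: the right derivative at $c$ and the left derivative at $b$. Since $f$ is defined only on $[c,b]$, at the endpoints the symbol $f'$ means the corresponding one-sided derivative: $f'(c)=f'(c+)$ and $f'(b)=f'(b-)$ (in hypothesis (ii) and in the recursion). The conclusion includes that the recursion is well defined, i.e. all $x_n$ lie in $[c,b]$. *)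

theory Defs
  imports Complex_Main
begin

(* The derivative is an explicit argument, so that at the endpoints of the domain of f
   it can be the one-sided derivative. *)
primrec newton_seq :: "(real \<Rightarrow> real) \<Rightarrow> (real \<Rightarrow> real) \<Rightarrow> real \<Rightarrow> nat \<Rightarrow> real" where
  "newton_seq f f' x0 0 = x0"
| "newton_seq f f' x0 (Suc n) = newton_seq f f' x0 n - f (newton_seq f f' x0 n) / f' (newton_seq f f' x0 n)"

end

theory Submission
  imports Defs
begin

text \<open>
  Up to replacing f by -f, the function is positive, increasing and convex on (c,b], so that
  f x / (x - c) is at most f' x and a Newton step never jumps over c. The iterates thus decrease
  to some L. If L > c, every step would have length at least f L / f' b > 0, which is impossible.
\<close>

text \<open>Inside \<open>{c..b}\<close> the filter at \<open>c\<close> is \<open>at_right c\<close>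
  and the filter at \<open>b\<close> is \<open>at_left b\<close>, so all three hypotheses are
  derivatives within the closed interval. Continuity up to both endpoints is what the mean and
  intermediate value theorems ask for later.\<close>

lemma continuous_on_Icc_one_sided_deriv:
  fixes f f' :: "real \<Rightarrow> real"
  assumes "c < b"
    and deriv: "\<And>x. x \<in> {c<..<b} \<Longrightarrow> (f has_real_derivative f' x) (at x)"
    and deriv_c: "(f has_real_derivative f' c) (at_right c)"
    and deriv_b: "(f has_real_derivative f' b) (at_left b)"
  shows "continuous_on {c..b} f"
proof -
  have "(f has_real_derivative f' x) (at x within {c..b})" if "x \<in> {c..b}" for x
  proof -
    consider "x = c" | "x = b" | "x \<in> {c<..<b}"
      using \<open>x \<in> {c..b}\<close> by force
    then show ?thesis
      using \<open>c < b\<close> deriv deriv_c deriv_b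
      by cases (simp_all add: at_within_Icc_at_right at_within_Icc_at_left
          has_field_derivative_at_within)
  qed
  then show ?thesis
    by (rule DERIV_continuous_on)
qed

text \<open>For \<open>y < b\<close> this is the sign of \<open>f''\<close>. The endpoint needs its
  own argument, because \<open>f' b\<close> is only a left derivative and nothing is assumed about
  \<open>f''\<close> or the continuity of \<open>f'\<close> there: the bound is shown for difference
  quotients at \<open>b\<close> and passed to the limit.\<close>

lemma convex_deriv_mono:
  fixes f f' f'' :: "real \<Rightarrow> real"
  assumes cont: "continuous_on {c..b} f"
    and deriv1: "\<And>x. x \<in> {c<..<b} \<Longrightarrow> (f has_real_derivative f' x) (at x)"
    and deriv2: "\<And>x. x \<in> {c<..<b} \<Longrightarrow> (f' has_real_derivative f'' x) (at x)"
    and deriv_b: "(f has_real_derivative f' b) (at_left b)"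
    and convex: "\<And>x. x \<in> {c<..<b} \<Longrightarrow> f'' x \<ge> 0"
    and "c < x" "x \<le> y" "y \<le> b"
  shows "f' x \<le> f' y"
proof -
  have mono: "f' u \<le> f' v" if "c < u" "u \<le> v" "v < b" for u v
    by (rule DERIV_nonneg_imp_nondecreasing[OF \<open>u \<le> v\<close>])
      (use that deriv2 convex in \<open>force intro!: exI[of _ "f'' _"]\<close>)
  consider "y < b" | "x = y" | "x < b" "y = b"
    using assms(7,8) by linarith
  then show ?thesis
  proof cases
    case 3
    \<comment> \<open>By the mean value theorem on \<open>{t..b}\<close> the quotient equals
      \<open>f' z\<close> for some \<open>z\<close> strictly between \<open>t\<close> and
      \<open>b\<close>, where the interior monotonicity applies.\<close>
    have quotient: "f' x \<le> (f t - f b) / (t - b)" if "t \<in> {x<..<b}" for t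
    proof -
      have "continuous_on {t..b} f"
        by (rule continuous_on_subset[OF cont]) (use that \<open>c < x\<close> in auto)
      moreover have "f differentiable (at s)" if "t < s" "s < b" for s
        using deriv1[of s] that \<open>t \<in> {x<..<b}\<close> \<open>c < x\<close>
        by (auto simp: real_differentiable_def)
      ultimately obtain l z where z: "t < z" "z < b" "DERIV f z :> l" "f b - f t = (b - t) * l"
        using MVT[of t b f] \<open>t \<in> {x<..<b}\<close> by auto
      then have "l = f' z"
        using deriv1[of z] that \<open>c < x\<close> by (auto intro: DERIV_unique)
      moreover have "(f t - f b) / (t - b) = l"
        using z(4) that by (simp add: field_simps)
      ultimately show ?thesis
        using mono[of x z] that z \<open>c < x\<close> by simp
    qed
    have "((\<lambda>t. (f t - f b) / (t - b)) \<longlongrightarrow> f' b) (at_left b)"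
      using deriv_b by (simp add: has_field_derivative_iff)
    moreover have "\<forall>\<^sub>F t in at_left b. f' x \<le> (f t - f b) / (t - b)"
      using eventually_at_left_real[OF \<open>x < b\<close>] by eventually_elim (rule quotient)
    ultimately show ?thesis
      using \<open>y = b\<close> by (auto intro: tendsto_lowerbound)
  qed (use mono \<open>c < x\<close> \<open>x \<le> y\<close> in auto)
qed

lemma newton_seq_tendsto_convex:
  fixes f f' f'' :: "real \<Rightarrow> real"
  assumes "c < b" "f c = 0"
    and cont: "continuous_on {c..b} f"
    and deriv1: "\<And>x. x \<in> {c<..<b} \<Longrightarrow> (f has_real_derivative f' x) (at x)"
    and deriv2: "\<And>x. x \<in> {c<..<b} \<Longrightarrow> (f' has_real_derivative f'' x) (at x)"
    and deriv_b: "(f has_real_derivative f' b) (at_left b)"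
    and convex: "\<And>x. x \<in> {c<..<b} \<Longrightarrow> f'' x \<ge> 0"
    and f_pos: "\<And>x. x \<in> {c<..b} \<Longrightarrow> f x > 0"
    and f'_pos: "\<And>x. x \<in> {c<..b} \<Longrightarrow> f' x > 0"
    and x0: "x0 \<in> {c..b}"
  shows "(\<forall>n. newton_seq f f' x0 n \<in> {c..b}) \<and> newton_seq f f' x0 \<longlonglongrightarrow> c"
proof -
  have f'_mono: "f' x \<le> f' y" if "c < x" "x \<le> y" "y \<le> b" for x y
    by (rule convex_deriv_mono[OF cont deriv1 deriv2 deriv_b convex that])
  have f_mono: "f x \<le> f y" if "c < x" "x \<le> y" "y \<le> b" for x y
  proof (cases "x = y")
    case False
    then have "x < y" using that by simp
    then have "f x < f y"
    \<comment> \<open>The open version of the rule asks for two-sided derivatives only between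
      \<open>x\<close> and \<open>y\<close>, so \<open>y = b\<close> is covered by
      continuity.\<close>
    proof (rule DERIV_pos_imp_increasing_open)
      show "continuous_on {x..y} f"
        by (rule continuous_on_subset[OF cont]) (use that in auto)
    qed (use deriv1 f'_pos that in force)
    then show ?thesis by simp
  qed simp
  \<comment> \<open>Convexity enters here: the chord from \<open>(c, 0)\<close> to
    \<open>(x, f x)\<close> has slope \<open>f' z\<close> for some \<open>z < x\<close>, hence is no
    steeper than the tangent at \<open>x\<close>. The tangent therefore meets the axis at or to the
    right of \<open>c\<close>.\<close>
  have step: "c \<le> x - f x / f' x" if x: "x \<in> {c<..b}" for x
  proof -
    have "continuous_on {c..x} f"
      by (rule continuous_on_subset[OF cont]) (use x in auto)
    moreover have "f differentiable (at s)" if "c < s" "s < x" for s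
      using deriv1[of s] that x by (auto simp: real_differentiable_def)
    ultimately obtain l z where z: "c < z" "z < x" "DERIV f z :> l" "f x - f c = (x - c) * l"
      using MVT[of c x f] x by auto
    then have "l = f' z"
      using deriv1[of z] x by (auto intro: DERIV_unique)
    then have "f x \<le> (x - c) * f' x"
      using z x \<open>f c = 0\<close> f'_mono[of z x] by (auto intro: mult_left_mono)
    then have "f x / f' x \<le> x - c"
      using f'_pos[OF x] by (simp add: pos_divide_le_eq)
    then show ?thesis by simp
  qed
  let ?x = "newton_seq f f' x0"
  have range: "?x n \<in> {c..b}" and dec: "?x (Suc n) \<le> ?x n" for n
  proof -
    \<comment> \<open>One inclusion serves both goals: its lower end keeps the iterates in
      \<open>{c..b}\<close>, its upper end makes them decrease. An iterate that reaches
      \<open>c\<close> stays there, since the numerator vanishes.\<close>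
    have next_le: "u - f u / f' u \<in> {c..u}" if "u \<in> {c..b}" for u
    proof (cases "u = c")
      case True
      then show ?thesis using \<open>f c = 0\<close> by simp
    next
      case False
      then have "u \<in> {c<..b}" using that by auto
      then show ?thesis
        using step[of u] f_pos[of u] f'_pos[of u] by (simp add: less_imp_le)
    qed
    show range: "?x n \<in> {c..b}"
    proof (induction n)
      case (Suc n)
      then show ?case using next_le[OF Suc] by auto
    qed (use x0 in simp)
    show "?x (Suc n) \<le> ?x n"
      using next_le[OF range] by simp
  qed
  obtain L where lim: "?x \<longlonglongrightarrow> L" and L: "\<And>n. L \<le> ?x n"
    using decseq_convergent[of ?x c] decseq_SucI[of ?x] dec range by auto
  have "L = c"
  proof (rule ccontr)
    assume "L \<noteq> c"
    moreover have "c \<le> L"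
      by (rule LIMSEQ_le_const[OF lim]) (use range in auto)
    ultimately have "c < L" by simp
    moreover have "L \<le> b"
      using L[of 0] range[of 0] by simp
    ultimately have "L \<in> {c<..b}" by simp
    \<comment> \<open>As \<open>L \<le> ?x n \<le> b\<close>, the numerator is smallest at
      \<open>L\<close> and the slope is largest at \<open>b\<close>. A uniform bound of this kind
      avoids taking the limit of \<open>f' (?x n)\<close>, which would call for continuity of
      \<open>f'\<close> at \<open>L\<close>.\<close>
    have "f L / f' b \<le> ?x n - ?x (Suc n)" for n
    proof -
      have n: "?x n \<in> {c<..b}" using L[of n] range[of n] \<open>c < L\<close> by auto
      have "f L / f' b \<le> f (?x n) / f' (?x n)"
      proof (rule frac_le)
        show "f L \<le> f (?x n)" using f_mono \<open>c < L\<close> L[of n] n by auto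
        show "f' (?x n) \<le> f' b" using f'_mono n by auto
      qed (use f_pos f'_pos n in \<open>auto intro: less_imp_le\<close>)
      then show ?thesis by simp
    qed
    moreover have "(\<lambda>n. ?x n - ?x (Suc n)) \<longlonglongrightarrow> L - L"
      by (intro tendsto_diff lim LIMSEQ_Suc)
    ultimately have "f L / f' b \<le> L - L"
      by (intro LIMSEQ_le_const) auto
    moreover have "0 < f L / f' b"
      using f_pos[OF \<open>L \<in> {c<..b}\<close>] f'_pos[of b] \<open>c < b\<close> by simp
    ultimately show False by simp
  qed
  then show ?thesis using range lim by simp
qed

text \<open>The signs cancel in the quotient of \<open>f\<close> by \<open>f'\<close>, so the case
  of negative \<open>f\<close> reduces to the positive one with the same iterates.\<close>

lemma newton_seq_uminus:
  "newton_seq (\<lambda>x. - f x) (\<lambda>x. - f' x) x0 = newton_seq f f' x0"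
proof
  show "newton_seq (\<lambda>x. - f x) (\<lambda>x. - f' x) x0 n = newton_seq f f' x0 n" for n
    by (induction n) simp_all
qed

theorem theorem2p2:
  fixes c b x0 :: real and f f' f'' :: "real \<Rightarrow> real"
  assumes "c < b"
    and root: "f c = 0"
    and root_unique: "\<And>x. x \<in> {c..b} \<Longrightarrow> f x = 0 \<Longrightarrow> x = c"
    and deriv1: "\<And>x. x \<in> {c<..<b} \<Longrightarrow> (f has_real_derivative f' x) (at x)"
    and deriv2: "\<And>x. x \<in> {c<..<b} \<Longrightarrow> (f' has_real_derivative f'' x) (at x)"
    and deriv_c: "(f has_real_derivative f' c) (at_right c)"
    and deriv_b: "(f has_real_derivative f' b) (at_left b)"
    and i: "\<And>x. x \<in> {c<..<b} \<Longrightarrow> f x * f'' x \<ge> 0"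
    and ii: "\<And>x. x \<in> {c<..b} \<Longrightarrow> f x * f' x > 0"
    and iii: "\<And>x. x \<in> {c<..<b} \<Longrightarrow> f' x \<noteq> 0" "f' c \<noteq> 0" "f' b \<noteq> 0"
    and x0: "x0 \<in> {c..b}"
  shows "(\<forall>n. newton_seq f f' x0 n \<in> {c..b}) \<and> newton_seq f f' x0 \<longlonglongrightarrow> c"
proof -
  have cont: "continuous_on {c..b} f"
    by (rule continuous_on_Icc_one_sided_deriv[OF \<open>c < b\<close> deriv1 deriv_c deriv_b])
  have nz: "f x \<noteq> 0" if "x \<in> {c<..b}" for x
    using root_unique[of x] that by auto
  have cont_b: "continuous_on {x..b} f" if "x \<in> {c<..b}" for x
    by (rule continuous_on_subset[OF cont]) (use that in auto)
  show ?thesis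
  \<comment> \<open>Having no zero in \<open>{c<..b}\<close>, the continuous \<open>f\<close> keeps
    one sign there by the intermediate value theorem, and its value at \<open>b\<close> tells
    which.\<close>
  proof (cases "f b > 0")
    case True
    have pos: "f x > 0" if x: "x \<in> {c<..b}" for x
    proof (rule ccontr)
      assume "\<not> f x > 0"
      then obtain z where "x \<le> z" "z \<le> b" "f z = 0"
        using IVT'[of f x 0 b] cont_b[OF x] True x by auto
      then show False using nz[of z] x by auto
    qed
    show ?thesis
    proof (rule newton_seq_tendsto_convex[OF \<open>c < b\<close> root cont deriv1 deriv2 deriv_b _ pos _ x0])
      show "f'' x \<ge> 0" if "x \<in> {c<..<b}" for x
        using i[OF that] pos[of x] that by (simp add: zero_le_mult_iff)
      show "f' x > 0" if "x \<in> {c<..b}" for x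
        using ii[OF that] pos[OF that] by (simp add: zero_less_mult_iff)
    qed
  next
    case False
    have neg: "f x < 0" if x: "x \<in> {c<..b}" for x
    proof (rule ccontr)
      assume "\<not> f x < 0"
      \<comment> \<open>The case gives only \<open>f b \<le> 0\<close>, so the zero found may be
        \<open>b\<close> itself; \<open>nz\<close> rules that out too.\<close>
      then obtain z where "x \<le> z" "z \<le> b" "f z = 0"
        using IVT2'[of f b 0 x] cont_b[OF x] False x by auto
      then show False using nz[of z] x by auto
    qed
    have "(\<forall>n. newton_seq (\<lambda>x. - f x) (\<lambda>x. - f' x) x0 n \<in> {c..b}) \<and>
        newton_seq (\<lambda>x. - f x) (\<lambda>x. - f' x) x0 \<longlonglongrightarrow> c"
    \<comment> \<open>Negating \<open>f\<close>, \<open>f'\<close> and \<open>f''\<close> together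
      leaves the products in \<open>i\<close> and \<open>ii\<close> unchanged, so \<open>-f\<close>
      meets the conditions of the positive case.\<close>
    proof (rule newton_seq_tendsto_convex[where f'' = "\<lambda>x. - f'' x"])
      show "- f'' x \<ge> 0" if "x \<in> {c<..<b}" for x
        using i[OF that] neg[of x] that by (simp add: zero_le_mult_iff)
      show "- f' x > 0" if "x \<in> {c<..b}" for x
        using ii[OF that] neg[OF that] by (simp add: zero_less_mult_iff)
    qed (use \<open>c < b\<close> root cont deriv1 deriv2 deriv_b neg x0 in
        \<open>auto intro!: continuous_intros DERIV_minus\<close>)
    then show ?thesis
      by (simp add: newton_seq_uminus)
  qed
qed

end
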